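(* For every integer $\ell \ge 3$, every $C_{\ell+1}$-free graph $G\neq K_\ell$ of chromatic number $\chi < \frac{5\ell+2}{3}$ satisfies $\varphi(G) \ge \chi - \ell + 1$.
   Context: All graphs are finite, simple and non-empty. $C_{\ell+1}$-free means $G$ contains no cycle of length exactly $\ell+1$ as a (not necessarily induced) subgraph. For a proper colouring $\sigma$ of $G$, $\varphi_\sigma(G)=\max_{H}\big(|\sigma(V(H))|-\chi(H)\big)$ over all induced subgraphs $H$ of $G$; the chromatic discrepancy is $\varphi(G)=\min_\sigma \varphi_\sigma(G)$ over all proper colourings $\sigma$ of $G$. *)

theory Defs
  imports Complex_Main "Graph_Theory.Graph_Theory"
begin

text \<open>
  Finite simple graphs are the symmetric digraphs without loops and parallel arcs of the locale
  \<^locale>\<open>graph\<close>; it allows the null graph, so non-emptiness has to be stated separately.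
\<close>

definition proper_colouring :: "('a, 'b) pre_digraph \<Rightarrow> ('a \<Rightarrow> 'c) \<Rightarrow> bool" where
  "proper_colouring G \<sigma> \<longleftrightarrow> (\<forall>u v. u \<rightarrow>\<^bsub>G\<^esub> v \<longrightarrow> \<sigma> u \<noteq> \<sigma> v)"

definition chromatic_number :: "('a, 'b) pre_digraph \<Rightarrow> nat" where
  "chromatic_number G = (LEAST k. \<exists>\<sigma> :: 'a \<Rightarrow> nat. proper_colouring G \<sigma> \<and> \<sigma> ` verts G \<subseteq> {..<k})"

text \<open>
  A cycle of the library is a closed directed walk with distinct vertices, given as its list of
  arcs. In a symmetric digraph every edge yields such a cycle of length 2; for \<open>k \<ge> 3\<close> the cycles
  of length \<open>k\<close> are exactly the (not necessarily induced) subgraphs \<open>C\<^sub>k\<close>, each one once for every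
  starting vertex and orientation.
\<close>

definition cycle_length_free :: "nat \<Rightarrow> ('a, 'b) pre_digraph \<Rightarrow> bool" where
  "cycle_length_free k G \<longleftrightarrow> \<not> (\<exists>p. pre_digraph.cycle G p \<and> length p = k)"

definition colouring_discrepancy :: "('a, 'b) pre_digraph \<Rightarrow> ('a \<Rightarrow> 'c) \<Rightarrow> int" where
  "colouring_discrepancy G \<sigma> =
     Max {int (card (\<sigma> ` verts H)) - int (chromatic_number H) | H.
            induced_subgraph H G \<and> verts H \<noteq> {}}"

text \<open>
  Natural numbers suffice as colours because the graphs are finite. There are infinitely many
  colourings, but only finitely many values of their discrepancies; see the lemmas below.
\<close>

definition chromatic_discrepancy :: "('a, 'b) pre_digraph \<Rightarrow> int" where
  "chromatic_discrepancy G =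
     Min {colouring_discrepancy G \<sigma> | \<sigma> :: 'a \<Rightarrow> nat. proper_colouring G \<sigma>}"

lemma (in graph) finite_induced_subgraphs: "finite {H. induced_subgraph H G}"
proof (rule finite_subset)
  show "{H. induced_subgraph H G} \<subseteq> (\<lambda>S. G \<restriction> S) ` Pow (verts G)"
  proof safe
    fix H assume "induced_subgraph H G"
    then have "H = G \<restriction> verts H" "verts H \<subseteq> verts G"
      by (auto simp: induce_subgraph_def induced_subgraph_def subgraph_def compatible_def)
    then show "H \<in> (\<lambda>S. G \<restriction> S) ` Pow (verts G)" by blast
  qed
qed simp

lemma (in graph) exists_proper_colouring:
  "\<exists>\<sigma> :: 'a \<Rightarrow> nat. proper_colouring G \<sigma> \<and> \<sigma> ` verts G \<subseteq> {..<card (verts G)}"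
proof -
  obtain f :: "'a \<Rightarrow> nat" where f: "bij_betw f (verts G) {0..<card (verts G)}"
    using ex_bij_betw_finite_nat finite_verts by blast
  have "proper_colouring G f"
    unfolding proper_colouring_def
    by (metis adj_in_verts(1,2) adj_not_same bij_betw_def f inj_onD)
  moreover have "f ` verts G \<subseteq> {..<card (verts G)}"
    using f by (auto simp: bij_betw_def)
  ultimately show ?thesis by blast
qed

lemma (in graph) chromatic_number_le: "chromatic_number G \<le> card (verts G)"
  unfolding chromatic_number_def using exists_proper_colouring by (rule Least_le)

lemma (in graph) colouring_discrepancy_set:
  assumes "verts G \<noteq> {}"
  shows "finite {int (card (\<sigma> ` verts H)) - int (chromatic_number H) | H.
            induced_subgraph H G \<and> verts H \<noteq> {}}" (is "finite ?A")
    and "{int (card (\<sigma> ` verts H)) - int (chromatic_number H) | H.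
            induced_subgraph H G \<and> verts H \<noteq> {}} \<noteq> {}"
proof -
  have "?A = (\<lambda>H. int (card (\<sigma> ` verts H)) - int (chromatic_number H)) `
          {H \<in> {H. induced_subgraph H G}. verts H \<noteq> {}}" by auto
  then show "finite ?A" using finite_induced_subgraphs by simp
  show "{int (card (\<sigma> ` verts H)) - int (chromatic_number H) | H.
          induced_subgraph H G \<and> verts H \<noteq> {}} \<noteq> {}" using assms induced_subgraph_refl by blast
qed

lemma (in graph) chromatic_discrepancy_set:
  assumes "verts G \<noteq> {}"
  shows "finite {colouring_discrepancy G \<sigma> | \<sigma> :: 'a \<Rightarrow> nat. proper_colouring G \<sigma>}" (is "finite ?B")
    and "{colouring_discrepancy G \<sigma> | \<sigma> :: 'a \<Rightarrow> nat. proper_colouring G \<sigma>} \<noteq> {}"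
proof -
  have "?B \<subseteq> {- int (card (verts G)) .. int (card (verts G))}"
  proof safe
    fix \<sigma> :: "'a \<Rightarrow> nat"
    let ?A = "{int (card (\<sigma> ` verts H)) - int (chromatic_number H) | H.
                 induced_subgraph H G \<and> verts H \<noteq> {}}"
    have "Max ?A \<in> ?A" using colouring_discrepancy_set[OF assms] by (rule Max_in)
    then obtain H where H: "induced_subgraph H G"
      and eq: "colouring_discrepancy G \<sigma> = int (card (\<sigma> ` verts H)) - int (chromatic_number H)"
      unfolding colouring_discrepancy_def by auto
    have dH: "digraph H" using H by (rule digraphI_induced)
    have *: "arcs H = {e \<in> arcs G. tail G e \<in> verts H \<and> head G e \<in> verts H}"
      "tail H = tail G" "head H = head G"
      using H by (simp_all add: induced_subgraph_def subgraph_def compatible_def)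
    have "symmetric H"
      unfolding symmetric_conv
    proof
      fix e assume e: "e \<in> arcs H"
      then have "e \<in> arcs G" by (simp add: *)
      then obtain e' where "e' \<in> arcs G" "tail G e = head G e'" "head G e = tail G e'"
        using sym_arcs unfolding symmetric_conv by blast
      with e show "\<exists>e'\<in>arcs H. tail H e = head H e' \<and> head H e = tail H e'"
        by (intro bexI[of _ e']) (simp_all add: *)
    qed
    then have gH: "graph H" using digraph.graphI[OF dH] by blast
    have sub: "verts H \<subseteq> verts G" using H by auto
    have "card (verts H) \<le> card (verts G)" using sub by (simp add: card_mono)
    moreover have "card (\<sigma> ` verts H) \<le> card (verts H)"
      using sub finite_verts by (meson card_image_le finite_subset)
    moreover have "chromatic_number H \<le> card (verts H)" using gH by (rule graph.chromatic_number_le)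
    ultimately show "colouring_discrepancy G \<sigma> \<in> {- int (card (verts G)) .. int (card (verts G))}"
      using eq by auto
  qed
  then show "finite ?B" by (rule finite_subset) simp
  show "{colouring_discrepancy G \<sigma> | \<sigma> :: 'a \<Rightarrow> nat. proper_colouring G \<sigma>} \<noteq> {}"
    using exists_proper_colouring by blast
qed

end

theory Submission
  imports Defs
begin

text \<open>
  Write \<open>\<chi> = l + t\<close>, so \<open>3 t \<le> 2 l + 1\<close>, and suppose that a colouring \<open>\<sigma>\<close> has discrepancy at most \<open>t\<close>:
  every \<open>k\<close>-colourable vertex set sees at most \<open>k + t\<close> colours.

  If \<open>\<sigma>\<close> had more than \<open>\<chi>\<close> colours, a rainbow set of \<open>l + t + 1\<close> vertices would not be
  \<open>l\<close>-colourable. It then contains a critical subgraph on at most \<open>l + t + 1\<close> vertices with minimum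
  degree at least \<open>l\<close>, which is so dense that it has a Hamiltonian cycle (Dirac) and cycles of all
  lengths (Bondy), with two small exceptions treated by hand.

  So \<open>\<sigma>\<close> has exactly \<open>\<chi>\<close> colours, and every colour class contains a vertex \<open>v\<close> that sees all other
  colours, say on a rainbow set \<open>X\<close> of neighbours. If the class of \<open>v\<close> contained a second vertex \<open>v'\<close>,
  then \<open>X \<union> {v'}\<close> would meet all colours and hence not be \<open>(l - 1)\<close>-colourable. As \<open>X\<close> lies in the
  neighbourhood of \<open>v\<close>, it spans no path on \<open>l\<close> vertices; this forces a clique of \<open>l - 1\<close> vertices in \<open>X\<close>
  joined completely to both \<open>v\<close> and \<open>v'\<close>, and a cycle of length \<open>l + 1\<close>. Therefore all classes are
  singletons, and \<open>G\<close> is complete.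
\<close>

section \<open>Paths, cycles and colourings of a symmetric relation\<close>

locale adjacency =
  fixes adj :: "'a \<Rightarrow> 'a \<Rightarrow> bool"
  assumes adj_sym: "adj x y \<Longrightarrow> adj y x"
    and adj_irrefl [simp]: "\<not> adj x x"
begin

definition path :: "'a list \<Rightarrow> bool" where
  "path xs \<longleftrightarrow> distinct xs \<and> successively adj xs"

text \<open>For \<open>q = 2\<close> a single edge qualifies, in line with the arc cycles in
  \<open>cycle_length_free\<close>; from \<open>q = 3\<close> on these are the genuine
  cycles.\<close>

definition has_cycle :: "'a set \<Rightarrow> nat \<Rightarrow> bool" where
  "has_cycle V q \<longleftrightarrow> (\<exists>xs. path xs \<and> set xs \<subseteq> V \<and> length xs = q \<and> adj (last xs) (hd xs))"

definition nbrs :: "'a set \<Rightarrow> 'a \<Rightarrow> 'a set" where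
  "nbrs V x = {y \<in> V. adj x y}"

definition proper_on :: "'a set \<Rightarrow> ('a \<Rightarrow> 'c) \<Rightarrow> bool" where
  "proper_on V c \<longleftrightarrow> (\<forall>x\<in>V. \<forall>y\<in>V. adj x y \<longrightarrow> c x \<noteq> c y)"

definition colourable :: "'a set \<Rightarrow> nat \<Rightarrow> bool" where
  "colourable V k \<longleftrightarrow> (\<exists>c :: 'a \<Rightarrow> nat. c ` V \<subseteq> {..<k} \<and> proper_on V c)"

lemma adj_commute: "adj x y \<longleftrightarrow> adj y x"
  using adj_sym by blast

lemma has_cycle_mono: "has_cycle V q \<Longrightarrow> V \<subseteq> W \<Longrightarrow> has_cycle W q"
  unfolding has_cycle_def by blast

lemma finite_nbrs [simp]: "finite V \<Longrightarrow> finite (nbrs V x)"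
  by (simp add: nbrs_def)

lemma nbrs_subset: "nbrs V x \<subseteq> V - {x}"
  by (auto simp: nbrs_def)

lemma path_Cons: "path (x # xs) \<longleftrightarrow> x \<notin> set xs \<and> path xs \<and> (xs = [] \<or> adj x (hd xs))"
  by (auto simp: path_def successively_Cons)

lemma path_append:
  "path (xs @ ys) \<longleftrightarrow> path xs \<and> path ys \<and> set xs \<inter> set ys = {} \<and>
     (xs = [] \<or> ys = [] \<or> adj (last xs) (hd ys))"
  by (auto simp: path_def successively_append_iff)

lemma path_rev [simp]: "path (rev xs) \<longleftrightarrow> path xs"
proof -
  have "(\<lambda>x y. adj y x) = adj"
    using adj_commute by blast
  then show ?thesis
    by (simp only: path_def distinct_rev successively_rev)
qed

lemma path_take: "path xs \<Longrightarrow> path (take n xs)"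
  by (metis append_take_drop_id path_append)

lemma path_drop: "path xs \<Longrightarrow> path (drop n xs)"
  by (metis append_take_drop_id path_append)

lemma path_rotate:
  assumes "path xs" "adj (last xs) (hd xs)"
  shows "path (rotate n xs)"
proof -
  let ?m = "n mod length xs"
  have "path (take ?m xs @ drop ?m xs)"
    using assms by simp
  then have p: "path (take ?m xs)" "path (drop ?m xs)" "set (take ?m xs) \<inter> set (drop ?m xs) = {}"
    unfolding path_append by blast+
  have "path (drop ?m xs @ take ?m xs)"
  proof (cases "take ?m xs = [] \<or> drop ?m xs = []")
    case False
    then have "last (drop ?m xs) = last xs" "hd (take ?m xs) = hd xs"
      by (auto simp: hd_conv_nth)
    then show ?thesis
      using assms p unfolding path_append by auto
  next
    case True
    then show ?thesis using p by auto
  qed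
  then show ?thesis
    by (simp add: rotate_drop_take)
qed

text \<open>Positions, unlike vertices, can be shifted against each other in the pigeonhole
  arguments on the two ends of a path.\<close>

lemma card_nbrs_conv_index:
  assumes "distinct xs"
  shows "card (nbrs (set xs) x) = card {i. i < length xs \<and> adj x (xs ! i)}"
proof -
  have "nbrs (set xs) x = (\<lambda>i. xs ! i) ` {i. i < length xs \<and> adj x (xs ! i)}"
    by (auto simp: nbrs_def in_set_conv_nth)
  moreover have "inj_on (\<lambda>i. xs ! i) {i. i < length xs \<and> adj x (xs ! i)}"
    using assms by (auto simp: inj_on_def nth_eq_iff_index_eq)
  ultimately show ?thesis
    by (simp add: card_image)
qed

section \<open>Longest paths and Dirac's theorem\<close>

lemma longest_path:
  assumes "finite V" "V \<noteq> {}"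
  obtains xs where "path xs" "set xs \<subseteq> V" "xs \<noteq> []"
    "\<And>ys. path ys \<Longrightarrow> set ys \<subseteq> V \<Longrightarrow> length ys \<le> length xs"
proof -
  obtain v where v: "v \<in> V" using assms by blast
  let ?P = "\<lambda>xs. path xs \<and> set xs \<subseteq> V"
  have "?P [v]" using v by (simp add: path_def)
  moreover have "\<forall>ys. ?P ys \<longrightarrow> length ys < Suc (card V)"
    using assms(1) by (metis card_mono distinct_card less_Suc_eq_le path_def)
  ultimately obtain xs where xs: "?P xs" "\<And>ys. ?P ys \<Longrightarrow> length ys \<le> length xs"
    using ex_has_greatest_nat[of ?P "[v]" length "Suc (card V)"] by blast
  have "xs \<noteq> []" using xs(2)[OF \<open>?P [v]\<close>] by auto
  with xs that show ?thesis by blast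
qed

lemma nbrs_last_longest_path:
  assumes "path xs" "set xs \<subseteq> V" "xs \<noteq> []"
    and max: "\<And>ys. path ys \<Longrightarrow> set ys \<subseteq> V \<Longrightarrow> length ys \<le> length xs"
  shows "nbrs V (last xs) \<subseteq> set xs - {last xs}"
proof
  fix y assume y: "y \<in> nbrs V (last xs)"
  then have "adj (last xs) y" "y \<in> V" by (auto simp: nbrs_def)
  have "y \<in> set xs"
  proof (rule ccontr)
    assume "y \<notin> set xs"
    moreover have "path [y]" by (simp add: path_def)
    ultimately have "path (xs @ [y])"
      using assms \<open>adj (last xs) y\<close> by (simp add: path_append)
    with max[of "xs @ [y]"] \<open>y \<in> V\<close> assms(2) show False by simp
  qed
  with y show "y \<in> set xs - {last xs}" by (auto simp: nbrs_def)
qed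

text \<open>Crossing chords: if the last vertex is joined to position \<open>j\<close> and the first
  to \<open>Suc j\<close>, then reversing the part after \<open>j\<close> turns the path into a
  cycle.\<close>

lemma path_imp_spanning_cycle:
  assumes "path xs" "xs \<noteq> []"
    and deg: "length xs \<le> card (nbrs (set xs) (hd xs)) + card (nbrs (set xs) (last xs))"
  obtains ys where "path ys" "set ys = set xs" "adj (last ys) (hd ys)"
proof -
  let ?n = "length xs"
  let ?I = "{i. i < ?n \<and> adj (hd xs) (xs ! i)}" and ?J = "{j. j < ?n \<and> adj (last xs) (xs ! j)}"
  have n: "0 < ?n" using assms(2) by simp
  have dist: "distinct xs" using assms(1) by (simp add: path_def)
  have I: "?I \<subseteq> {1..<?n}"
    using n by (auto simp: hd_conv_nth Suc_le_eq intro!: gr0I)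
  have J: "Suc ` ?J \<subseteq> {1..<?n}"
  proof
    fix i assume "i \<in> Suc ` ?J"
    then obtain j where j: "i = Suc j" "j < ?n" "adj (last xs) (xs ! j)" by auto
    then have "j \<noteq> ?n - 1" using assms(2) by (auto simp: last_conv_nth)
    with j show "i \<in> {1..<?n}" by auto
  qed
  \<comment> \<open>Both sets lie among \<open>?n - 1\<close> positions, but by \<open>deg\<close>
    their sizes add up to at least \<open>?n\<close>.\<close>
  have "?I \<inter> Suc ` ?J \<noteq> {}"
  proof
    assume "?I \<inter> Suc ` ?J = {}"
    then have "card ?I + card (Suc ` ?J) = card (?I \<union> Suc ` ?J)"
      by (intro card_Un_disjoint[symmetric]) auto
    also have "\<dots> \<le> card {1..<?n}"
      using I J by (intro card_mono) auto
    finally have "card ?I + card ?J \<le> ?n - 1"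
      by (simp add: card_image)
    with deg n show False
      unfolding card_nbrs_conv_index[OF dist] by linarith
  qed
  then obtain j where j: "Suc j < ?n" "adj (hd xs) (xs ! Suc j)" "adj (last xs) (xs ! j)"
    by auto
  let ?ys = "take (Suc j) xs @ rev (drop (Suc j) xs)"
  have "path (take (Suc j) xs @ drop (Suc j) xs)" using assms by simp
  moreover have "last (take (Suc j) xs) = xs ! j"
    using j by (simp add: take_Suc_conv_app_nth)
  ultimately have "path ?ys"
    using j unfolding path_append by (auto simp: hd_rev adj_commute)
  moreover have "set ?ys = set xs"
    by (metis append_take_drop_id set_append set_rev)
  moreover have "last ?ys = xs ! Suc j" "hd ?ys = hd xs"
    using j assms(2) by (auto simp: last_rev hd_drop_conv_nth hd_append)
  ultimately show ?thesis
    using that j adj_commute by metis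
qed

text \<open>Dirac's theorem. The ends of a longest path have all their neighbours on it, so it
  closes up to a cycle; an outside vertex with a neighbour on the cycle would yield a longer
  path.\<close>

lemma hamiltonian_cycle:
  assumes "finite V" "V \<noteq> {}" and deg: "\<And>x. x \<in> V \<Longrightarrow> card V \<le> 2 * card (nbrs V x)"
  obtains xs where "path xs" "set xs = V" "adj (last xs) (hd xs)"
proof -
  obtain xs where xs: "path xs" "set xs \<subseteq> V" "xs \<noteq> []"
    and max: "\<And>ys. path ys \<Longrightarrow> set ys \<subseteq> V \<Longrightarrow> length ys \<le> length xs"
    using longest_path assms by metis
  have dist: "distinct xs" using xs by (simp add: path_def)
  then have len: "card (set xs) = length xs" by (rule distinct_card)
  have last: "nbrs V (last xs) \<subseteq> set xs - {last xs}"
    using nbrs_last_longest_path[OF xs max] .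
  have "nbrs V (last (rev xs)) \<subseteq> set (rev xs) - {last (rev xs)}"
    using xs max by (intro nbrs_last_longest_path) auto
  then have hd: "nbrs V (hd xs) \<subseteq> set xs"
    by (auto simp: last_rev)
  have "nbrs V (hd xs) = nbrs (set xs) (hd xs)" "nbrs V (last xs) = nbrs (set xs) (last xs)"
    using hd last xs(2) by (auto simp: nbrs_def)
  moreover have "hd xs \<in> V" "last xs \<in> V" using xs by auto
  moreover have "length xs \<le> card V"
    using len xs(2) assms(1) by (metis card_mono)
  ultimately have "length xs \<le> card (nbrs (set xs) (hd xs)) + card (nbrs (set xs) (last xs))"
    using deg[of "hd xs"] deg[of "last xs"] by simp
  then obtain ys where ys: "path ys" "set ys = set xs" "adj (last ys) (hd ys)"
    using path_imp_spanning_cycle xs by metis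
  have "set xs = V"
  proof (rule ccontr)
    assume "set xs \<noteq> V"
    then obtain y where y: "y \<in> V" "y \<notin> set xs" using xs(2) by blast
    have "card (nbrs V (last xs)) \<le> card (set xs - {last xs})"
      using last by (intro card_mono) auto
    also have "\<dots> = length xs - 1"
      using xs(3) len by simp
    finally have *: "card V \<le> 2 * (length xs - 1)"
      using deg[OF \<open>last xs \<in> V\<close>] by simp
    \<comment> \<open>The path contains all neighbours of its end, hence more than half of
      \<open>V\<close>; the vertices outside are too few for the degree of \<open>y\<close>.\<close>
    have "nbrs V y \<inter> set xs \<noteq> {}"
    proof
      assume "nbrs V y \<inter> set xs = {}"
      then have "nbrs V y \<subseteq> V - insert y (set xs)"
        by (auto simp: nbrs_def)
      then have "card (nbrs V y) \<le> card (V - insert y (set xs))"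
        using assms(1) by (intro card_mono) auto
      also have "\<dots> = card V - Suc (length xs)"
        using y xs(2) len by (subst card_Diff_subset) auto
      finally show False
        using deg[OF y(1)] * xs(3) y(1) assms(1) card_gt_0_iff[of V] by (cases xs) auto
    qed
    then have "\<exists>z\<in>set ys. adj y z"
      using ys(2) by (auto simp: nbrs_def)
    then obtain i where i: "i < length ys" "adj y (ys ! i)"
      by (metis in_set_conv_nth)
    then have "hd (rotate i ys) = ys ! i"
      by (subst hd_rotate_conv_nth) auto
    moreover have "path (rotate i ys)"
      using ys by (intro path_rotate) auto
    ultimately have "path (y # rotate i ys)"
      using i y ys(2) unfolding path_Cons by auto
    moreover have "set (y # rotate i ys) \<subseteq> V"
      using y ys xs by auto
    ultimately have "length (y # rotate i ys) \<le> length xs"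
      by (rule max)
    moreover have "length ys = length xs"
      using ys dist by (metis distinct_card path_def)
    ultimately show False by simp
  qed
  with ys that show ?thesis by metis
qed

section \<open>Cycles of all lengths, after Bondy\<close>

text \<open>Without a cycle of length \<open>q\<close>, each chord at the first vertex rules out one
  at the last, and distinct chords rule out distinct ones; this bounds the degree sum of these two
  consecutive vertices by \<open>length xs\<close>.\<close>

lemma spanning_cycle_imp_cycle:
  assumes xs: "path xs" "adj (last xs) (hd xs)" and q: "3 \<le> q" "q \<le> length xs"
    and deg: "length xs < card (nbrs (set xs) (hd xs)) + card (nbrs (set xs) (last xs))"
  shows "has_cycle (set xs) q"
proof (rule ccontr)
  assume no: "\<not> has_cycle (set xs) q"
  let ?n = "length xs"
  have ne: "xs \<noteq> []" using q by auto
  have dist: "distinct xs" using xs by (simp add: path_def)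
  \<comment> \<open>The closing edge is left out of \<open>I\<close>, where it would be position
    \<open>?n - 1\<close>, but stays in \<open>J\<close> as position 0.\<close>
  define I where "I = {k. 1 \<le> k \<and> k < ?n - 1 \<and> adj (hd xs) (xs ! k)}"
  define J where "J = {j. j < ?n - 1 \<and> adj (last xs) (xs ! j)}"
  \<comment> \<open>A chord from the first vertex to position \<open>k\<close> and one from the last vertex to position \<open>\<phi> k\<close>
    together close a cycle of length \<open>q\<close>.\<close>
  define \<phi> where "\<phi> k = (if k \<le> ?n - q then k + q - 3 else k - (?n + 1 - q))" for k
  have "{i. i < ?n \<and> adj (hd xs) (xs ! i)} = insert (?n - 1) I"
  proof (intro set_eqI iffI)
    fix i assume i: "i \<in> {i. i < ?n \<and> adj (hd xs) (xs ! i)}"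
    then have "i \<noteq> 0" using ne by (intro notI) (auto simp: hd_conv_nth)
    then show "i \<in> insert (?n - 1) I"
      using i by (auto simp: I_def)
  next
    fix i assume "i \<in> insert (?n - 1) I"
    then show "i \<in> {i. i < ?n \<and> adj (hd xs) (xs ! i)}"
      using xs(2) ne by (auto simp: I_def last_conv_nth adj_commute)
  qed
  then have "card (nbrs (set xs) (hd xs)) = Suc (card I)"
    using dist by (simp add: card_nbrs_conv_index I_def)
  moreover have "{i. i < ?n \<and> adj (last xs) (xs ! i)} = J"
  proof (intro set_eqI iffI)
    fix i assume i: "i \<in> {i. i < ?n \<and> adj (last xs) (xs ! i)}"
    then have "i \<noteq> ?n - 1" using ne by (auto simp: last_conv_nth)
    then show "i \<in> J" using i by (auto simp: J_def)
  qed (auto simp: J_def)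
  then have "card (nbrs (set xs) (last xs)) = card J"
    using dist by (simp add: card_nbrs_conv_index)
  ultimately have large: "?n \<le> card I + card J" using deg by simp
  \<comment> \<open>On \<open>I\<close> the first branch of \<open>\<phi>\<close> takes values from
    \<open>q - 2\<close> on, the second values up to \<open>q - 3\<close>.\<close>
  have inj: "inj_on \<phi> I"
    using q by (auto simp: inj_on_def \<phi>_def I_def split: if_splits)
  have disj: "\<phi> ` I \<inter> J = {}"
  proof (rule ccontr)
    assume "\<phi> ` I \<inter> J \<noteq> {}"
    then obtain k where "k \<in> I" "\<phi> k \<in> J" by auto
    then have k: "1 \<le> k" "k < ?n - 1" "adj (hd xs) (xs ! k)"
      and j: "\<phi> k < ?n - 1" "adj (last xs) (xs ! \<phi> k)"
      by (auto simp: I_def J_def)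
    obtain ys where ys: "path ys" "set ys \<subseteq> set xs" "length ys = q" "adj (last ys) (hd ys)"
    proof (cases "k \<le> ?n - q")
      case True
      \<comment> \<open>The cycle goes from \<open>hd xs\<close> over one chord to the
        \<open>q - 2\<close> vertices at positions \<open>k\<close> to \<open>\<phi> k\<close>, over
        the other chord to \<open>last xs\<close>, and back along the closing edge.\<close>
      let ?m = "take (q - 2) (drop k xs)"
      have split: "xs = [hd xs] @ tl (butlast xs) @ [last xs]"
        using q by (cases xs; cases "tl xs") auto
      have m: "?m = take (q - 2) (drop (k - 1) (tl (butlast xs)))"
        using True q k by (auto intro!: nth_equalityI simp: nth_tl nth_butlast)
      have "path ([hd xs] @ tl (butlast xs) @ [last xs])"
        using xs split by metis
      then have "path (tl (butlast xs))" "hd xs \<notin> set (tl (butlast xs))"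
        "last xs \<notin> set (tl (butlast xs))" "hd xs \<noteq> last xs"
        unfolding path_append by auto
      moreover have "set ?m \<subseteq> set (tl (butlast xs))"
        unfolding m by (meson order_trans set_drop_subset set_take_subset)
      ultimately have "path ?m" "hd xs \<notin> set ?m" "last xs \<notin> set ?m" "hd xs \<noteq> last xs"
        using xs by (auto intro: path_take path_drop)
      moreover have "hd ?m = xs ! k" "?m \<noteq> []"
        using True q k by (auto simp: hd_drop_conv_nth)
      moreover have "last ?m = xs ! \<phi> k"
      proof -
        have "length ?m = q - 2" using True q by auto
        then have "last ?m = ?m ! (q - 3)"
          using q \<open>?m \<noteq> []\<close> by (simp add: last_conv_nth)
        also have "\<dots> = xs ! \<phi> k"
          using True q by (simp add: \<phi>_def)
        finally show ?thesis .
      qed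
      ultimately have "path ([hd xs] @ ?m @ [last xs])"
        using k j unfolding path_append by (auto simp: path_def adj_commute)
      moreover have "set ([hd xs] @ ?m @ [last xs]) \<subseteq> set xs"
        using ne by (auto dest!: in_set_takeD in_set_dropD)
      moreover have "length ([hd xs] @ ?m @ [last xs]) = q"
        using True q by auto
      moreover have "adj (last ([hd xs] @ ?m @ [last xs])) (hd ([hd xs] @ ?m @ [last xs]))"
        using xs by simp
      ultimately show ?thesis by (rule that)
    next
      case False
      then have \<phi>: "\<phi> k = k - (?n + 1 - q)" "\<phi> k < k"
        using q by (auto simp: \<phi>_def)
      \<comment> \<open>From the first vertex to position \<open>\<phi> k\<close>, over a chord to
        the last vertex, backwards to position \<open>k\<close> and over the other chord home; the
        \<open>?n - q\<close> vertices in between are skipped.\<close>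
      let ?ys = "take (Suc (\<phi> k)) xs @ rev (drop k xs)"
      have "set (take (Suc (\<phi> k)) xs) \<inter> set (drop k xs) = {}"
        using dist \<phi> by (intro set_take_disj_set_drop_if_distinct) auto
      moreover have "last (take (Suc (\<phi> k)) xs) = xs ! \<phi> k"
        using j by (simp add: take_Suc_conv_app_nth)
      ultimately have "path ?ys"
        using j k xs unfolding path_append
        by (auto simp: hd_rev adj_commute intro: path_take path_drop)
      moreover have "set ?ys \<subseteq> set xs"
        by (auto dest!: in_set_takeD in_set_dropD)
      moreover have "length ?ys = q"
        using False \<phi> q k by auto
      moreover have "last ?ys = xs ! k" "hd ?ys = hd xs"
        using k ne by (auto simp: last_rev hd_drop_conv_nth hd_append)
      ultimately show ?thesis
        using that k adj_commute by metis
    qed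
    with no show False unfolding has_cycle_def by blast
  qed
  have "card I + card J = card (\<phi> ` I \<union> J)"
    using inj disj by (subst card_Un_disjoint) (auto simp: card_image I_def J_def)
  also have "\<dots> \<le> card {..<?n - 1}"
    using q by (intro card_mono) (auto simp: \<phi>_def I_def J_def)
  also have "\<dots> < ?n" using ne by (cases xs) auto
  finally show False using large by simp
qed

lemma cycle_if_large_degrees:
  assumes "finite V" "3 \<le> q" "q \<le> card V"
    and deg: "\<And>x. x \<in> V \<Longrightarrow> card V < 2 * card (nbrs V x)"
  shows "has_cycle V q"
proof -
  have "V \<noteq> {}" using assms by auto
  then obtain xs where xs: "path xs" "set xs = V" "adj (last xs) (hd xs)"
    using hamiltonian_cycle assms(1) deg less_imp_le by metis
  have "length xs = card V" using xs by (metis distinct_card path_def)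
  moreover have "xs \<noteq> []" using xs \<open>V \<noteq> {}\<close> by auto
  then have "hd xs \<in> V" "last xs \<in> V" using xs(2) by auto
  moreover from this have "card V < card (nbrs V (hd xs)) + card (nbrs V (last xs))"
    using deg[of "hd xs"] deg[of "last xs"] by linarith
  ultimately show ?thesis
    using spanning_cycle_imp_cycle[OF xs(1,3), of q] assms(2,3) xs(2) by simp
qed

section \<open>Colourability, critical sets and recolouring\<close>

lemma colourableI:
  assumes "proper_on V c" "finite C" "c ` V \<subseteq> C" "card C \<le> k"
  shows "colourable V k"
proof -
  obtain f where f: "f ` C \<subseteq> {..<k}" "inj_on f C"
    using assms(2,4) by (metis card_le_inj card_lessThan finite_lessThan)
  then have "proper_on V (f \<circ> c)"
    using assms(1,3) unfolding proper_on_def o_def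
    by (metis image_subset_iff inj_on_contraD)
  moreover have "(f \<circ> c) ` V \<subseteq> {..<k}"
    using f(1) assms(3) by auto
  ultimately show ?thesis unfolding colourable_def by blast
qed

lemma colourable_card: "finite V \<Longrightarrow> colourable V (card V)"
  by (rule colourableI[of V id V]) (auto simp: proper_on_def)

lemma colourable_mono_bound: "colourable V k \<Longrightarrow> k \<le> k' \<Longrightarrow> colourable V k'"
  unfolding colourable_def by (meson lessThan_subset_iff order_trans)

text \<open>Vertices are deleted as long as the set stays non-colourable. Afterwards every deletion
  leaves a \<open>k\<close>-colourable set, and a vertex with fewer than \<open>k\<close> neighbours
  could take a colour that these do not use.\<close>

lemma critical_subset:
  assumes "finite V" "\<not> colourable V k"
  obtains S where "S \<subseteq> V" "\<not> colourable S k" "\<And>x. x \<in> S \<Longrightarrow> k \<le> card (nbrs S x)"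
proof -
  have "\<exists>S. S \<subseteq> V \<and> \<not> colourable S k \<and> (\<forall>x\<in>S. k \<le> card (nbrs S x))"
    using assms
  proof (induction V rule: finite_psubset_induct)
    case (psubset V)
    show ?case
    proof (cases "\<exists>x\<in>V. \<not> colourable (V - {x}) k")
      case True
      then obtain x where "x \<in> V" "\<not> colourable (V - {x}) k" by blast
      then show ?thesis using psubset.IH[of "V - {x}"] by blast
    next
      case False
      have "k \<le> card (nbrs V x)" if "x \<in> V" for x
      proof (rule ccontr)
        assume small: "\<not> k \<le> card (nbrs V x)"
        obtain c :: "'a \<Rightarrow> nat" where c: "c ` (V - {x}) \<subseteq> {..<k}" "proper_on (V - {x}) c"
          using False \<open>x \<in> V\<close> unfolding colourable_def by blast
        have "card (c ` nbrs V x) < card {..<k}"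
          using small card_image_le[of "nbrs V x" c] psubset.hyps by simp
        then obtain a where a: "a \<in> {..<k}" "a \<notin> c ` nbrs V x"
          by (metis card_mono finite_imageI finite_nbrs leD psubset.hyps subsetI)
        have "proper_on V (c(x := a))"
          using c(2) a(2) unfolding proper_on_def nbrs_def by (auto simp: adj_commute)
        moreover have "(c(x := a)) ` V \<subseteq> {..<k}"
          using c(1) a(1) by auto
        ultimately show False using psubset.prems unfolding colourable_def by blast
      qed
      then show ?thesis using psubset.prems by blast
    qed
  qed
  with that show ?thesis by blast
qed

text \<open>Every vertex of the class \<open>a\<close> moves to another colour absent from its
  neighbourhood. The class is independent, so all moves can be made at once, and \<open>a\<close>
  disappears.\<close>

lemma missed_colour_imp_colourable:
  assumes "finite V" "proper_on V c"
    and missed: "\<And>v. v \<in> V \<Longrightarrow> c v = a \<Longrightarrow> \<exists>b\<in>c ` V - {a}. b \<notin> c ` nbrs V v"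
    and "a \<in> c ` V"
  shows "colourable V (card (c ` V) - 1)"
proof -
  obtain f where f: "\<And>v. v \<in> V \<Longrightarrow> c v = a \<Longrightarrow> f v \<in> c ` V - {a} \<and> f v \<notin> c ` nbrs V v"
    using missed by metis
  let ?d = "\<lambda>v. if c v = a then f v else c v"
  have "proper_on V ?d"
    unfolding proper_on_def
  proof (intro ballI impI)
    fix x y assume xy: "x \<in> V" "y \<in> V" "adj x y"
    then have "c x \<in> c ` nbrs V y" "c y \<in> c ` nbrs V x" "c x \<noteq> c y"
      using assms(2) by (auto simp: nbrs_def adj_commute proper_on_def)
    then show "?d x \<noteq> ?d y"
      using f[of x] f[of y] xy by auto
  qed
  moreover have "?d ` V \<subseteq> c ` V - {a}" using f by auto
  ultimately show ?thesis
    using assms(1,4) by (intro colourableI[of V ?d "c ` V - {a}"]) auto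
qed

section \<open>Cycles of a prescribed length\<close>

lemma has_cycle_if_clique:
  assumes "finite V" "3 \<le> q" "q \<le> card V" "\<And>x y. x \<in> V \<Longrightarrow> y \<in> V \<Longrightarrow> x \<noteq> y \<Longrightarrow> adj x y"
  shows "has_cycle V q"
proof (rule cycle_if_large_degrees[OF assms(1-3)])
  fix x assume "x \<in> V"
  then have "nbrs V x = V - {x}" using assms(4) by (auto simp: nbrs_def)
  then show "card V < 2 * card (nbrs V x)"
    using assms(1-3) \<open>x \<in> V\<close> by simp
qed

lemma has_cycle_if_path_in_nbrs:
  assumes "v \<in> V" "path xs" "set xs \<subseteq> nbrs V v" "length xs = l" "1 \<le> l"
  shows "has_cycle V (l + 1)"
proof -
  have "xs \<noteq> []" using assms by auto
  then have "hd xs \<in> nbrs V v" "last xs \<in> nbrs V v" using assms(3) by auto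
  then have "path (v # xs)" "adj (last (v # xs)) (hd (v # xs))"
    using assms \<open>xs \<noteq> []\<close> by (auto simp: path_Cons nbrs_def adj_commute)
  moreover have "set (v # xs) \<subseteq> V" using assms by (auto simp: nbrs_def)
  ultimately show ?thesis using assms(4) unfolding has_cycle_def by fastforce
qed

lemma obtain_two_elements:
  assumes "2 \<le> card A"
  obtains a b where "a \<in> A" "b \<in> A" "a \<noteq> b"
proof -
  obtain B where "B \<subseteq> A" "card B = 2"
    using obtain_subset_with_card_n[OF assms] by blast
  then show ?thesis
    using that unfolding card_2_iff by blast
qed

lemma has_cycle_if_two_common_nbrs:
  assumes "v \<in> V" "w \<in> V" "v \<noteq> w" "2 \<le> card (nbrs V v \<inter> nbrs V w)"
  shows "has_cycle V 4"
proof -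
  obtain a b where ab: "a \<in> nbrs V v \<inter> nbrs V w" "b \<in> nbrs V v \<inter> nbrs V w" "a \<noteq> b"
    using obtain_two_elements[OF assms(4)] by blast
  then have "path [v, a, w, b]" "adj b v" "{v, a, w, b} \<subseteq> V"
    using assms by (auto simp: path_Cons nbrs_def adj_commute path_def)
  then show ?thesis unfolding has_cycle_def by (intro exI[of _ "[v, a, w, b]"]) auto
qed

text \<open>The cycle is \<open>v\<close>, \<open>a\<close>, \<open>w\<close>, \<open>w'\<close>,
  \<open>b\<close>; the second common neighbour with \<open>w'\<close> ensures that \<open>b\<close>
  can differ from \<open>a\<close>.\<close>

lemma has_cycle_if_adjacent_with_common_nbrs:
  assumes "v \<in> V" "w \<in> V" "w' \<in> V" "v \<noteq> w" "v \<noteq> w'" "adj w w'" "\<not> adj v w" "\<not> adj v w'"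
    and "1 \<le> card (nbrs V v \<inter> nbrs V w)" "2 \<le> card (nbrs V v \<inter> nbrs V w')"
  shows "has_cycle V 5"
proof -
  obtain a where a: "a \<in> nbrs V v \<inter> nbrs V w"
    using assms(9) by (metis card.empty ex_in_conv not_one_le_zero)
  obtain b where b: "b \<in> nbrs V v \<inter> nbrs V w'" "b \<noteq> a"
    using obtain_two_elements[OF assms(10)] by metis
  have "path [v, a, w, w', b]" "adj b v" "{v, a, w, w', b} \<subseteq> V"
    using a b assms by (auto simp: path_Cons nbrs_def adj_commute path_def)
  then show ?thesis unfolding has_cycle_def by (intro exI[of _ "[v, a, w, w', b]"]) auto
qed

text \<open>A critical subset \<open>S\<close> has degrees at least \<open>l\<close>, usually more
  than half its size. In the exceptions some \<open>v\<close> has so few non-neighbours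
  \<open>W\<close> that each of them shares two neighbours with it.\<close>

lemma has_cycle_if_not_colourable:
  assumes "finite T" "\<not> colourable T l" "card T \<le> l + t + 1" "3 * t \<le> 2 * l + 1" "3 \<le> l"
  shows "has_cycle T (l + 1)"
proof -
  obtain S where S: "S \<subseteq> T" "\<not> colourable S l" and deg: "\<And>x. x \<in> S \<Longrightarrow> l \<le> card (nbrs S x)"
    using critical_subset assms(1,2) by metis
  have fin: "finite S" using S(1) assms(1) finite_subset by blast
  have card: "card S \<le> l + t + 1" using S(1) assms(1,3) card_mono order_trans by blast
  have large: "l + 1 \<le> card S"
    using S(2) colourable_mono_bound[OF colourable_card[OF fin], of l] by linarith
  have "has_cycle S (l + 1)"
  proof (cases "\<exists>v\<in>S. 2 * card (nbrs S v) \<le> card S")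
    case False
    then show ?thesis
      using fin large assms(5) by (intro cycle_if_large_degrees) auto
  next
    case True
    then obtain v where v: "v \<in> S" "2 * card (nbrs S v) \<le> card S" by blast
    \<comment> \<open>The degree condition fails only when \<open>t = l - 1\<close>, which \<open>3 * t \<le> 2 * l + 1\<close> allows for
      \<open>l \<le> 4\<close> only.\<close>
    with deg[OF v(1)] card assms(4,5) have l: "l = 3 \<or> l = 4" and cS: "card S = 2 * l"
      and dv: "card (nbrs S v) = l"
      by linarith+
    define W where "W = S - insert v (nbrs S v)"
    have cW: "card W = l - 1"
    proof -
      have "card W = card S - card (insert v (nbrs S v))"
        unfolding W_def using v fin by (intro card_Diff_subset) (auto simp: nbrs_def)
      also have "card (insert v (nbrs S v)) = l + 1"
        using fin dv by (simp add: nbrs_def)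
      finally show ?thesis using cS by simp
    qed
    have fW: "finite W" using fin by (simp add: W_def)
    \<comment> \<open>\<open>w\<close> has at least \<open>l\<close> neighbours; \<open>v\<close> is
      not among them, and at most \<open>l - 2\<close> lie in \<open>W\<close>.\<close>
    have common: "2 \<le> card (nbrs S v \<inter> nbrs S w)" if "w \<in> W" for w
    proof -
      have "nbrs S w \<subseteq> (nbrs S v \<inter> nbrs S w) \<union> (W - {w})"
        using that by (auto simp: nbrs_def W_def adj_commute)
      then have "card (nbrs S w) \<le> card ((nbrs S v \<inter> nbrs S w) \<union> (W - {w}))"
        using fin fW by (intro card_mono) auto
      also have "\<dots> \<le> card (nbrs S v \<inter> nbrs S w) + card (W - {w})"
        by (rule card_Un_le)
      also have "card (W - {w}) = l - 2"
        using fW that cW by simp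
      finally show ?thesis
        using deg[of w] that assms(5) by (auto simp: W_def)
    qed
    from l show ?thesis
    proof
      assume l: "l = 3"
      then obtain w where "w \<in> W" using cW by fastforce
      then show ?thesis
        using has_cycle_if_two_common_nbrs[OF v(1), of w] common[of w] l by (auto simp: W_def)
    next
      assume l: "l = 4"
      \<comment> \<open>Without a 5-cycle, \<open>W\<close> together with \<open>v\<close> is
        independent and \<open>nbrs S v\<close> is not a clique; this leads to a 4-colouring of
        \<open>S\<close>.\<close>
      show ?thesis
      proof (rule ccontr)
        assume no: "\<not> has_cycle S (l + 1)"
        have indep: "\<not> adj x y" if "x \<in> W" "y \<in> W" for x y
          using has_cycle_if_adjacent_with_common_nbrs[OF v(1), of x y] common[of x] common[of y]
            that no l by (auto simp: W_def nbrs_def)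
        let ?N = "nbrs S v"
        have "\<exists>x\<in>?N. \<exists>y\<in>?N. x \<noteq> y \<and> \<not> adj x y"
        proof (rule ccontr)
          assume "\<not> (\<exists>x\<in>?N. \<exists>y\<in>?N. x \<noteq> y \<and> \<not> adj x y)"
          moreover have "card (insert v ?N) = 5"
            using fin dv l by (simp add: nbrs_def)
          ultimately have "has_cycle (insert v ?N) (l + 1)"
            using fin l by (intro has_cycle_if_clique) (auto simp: nbrs_def adj_commute)
          then show False using no has_cycle_mono v(1) by (metis Diff_subset insert_subset nbrs_subset order_trans)
        qed
        then obtain x y where xy: "x \<in> ?N" "y \<in> ?N" "x \<noteq> y" "\<not> adj x y" by blast
        \<comment> \<open>Vertices serve as colours: \<open>v\<close> for itself and
          \<open>W\<close>, and one for each of its four neighbours except that \<open>y\<close>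
          shares that of \<open>x\<close>.\<close>
        let ?c = "\<lambda>z. if z = y then x else if z \<in> ?N then z else v"
        have "proper_on S ?c"
          unfolding proper_on_def
        proof (intro ballI impI)
          fix p q assume pq: "p \<in> S" "q \<in> S" "adj p q"
          have "p \<in> ?N \<or> q \<in> ?N"
          proof (rule ccontr)
            assume "\<not> ?thesis"
            then consider "p = v" "q \<notin> ?N" | "q = v" "p \<notin> ?N" | "p \<in> W" "q \<in> W"
              using pq by (auto simp: W_def)
            then show False
              using pq indep adj_sym[OF pq(3)] by cases (auto simp: nbrs_def)
          qed
          moreover have "p \<noteq> q" "v \<notin> ?N" using pq by (auto simp: nbrs_def)
          ultimately show "?c p \<noteq> ?c q"
            using xy pq by (auto simp: adj_commute split: if_splits)
        qed
        moreover have "card (insert v ?N - {y}) = 4"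
          using fin dv l xy by (simp add: nbrs_def)
        moreover have "?c ` S \<subseteq> insert v ?N - {y}"
          using xy by (auto simp: nbrs_def)
        ultimately have "colourable S 4"
          using fin by (intro colourableI[of S ?c "insert v ?N - {y}"]) auto
        then show False using S(2) l by simp
      qed
    qed
  qed
  then show ?thesis using S(1) has_cycle_mono by blast
qed

text \<open>The end of a longest path has its neighbours on the path, and \<open>short\<close> keeps
  the path to \<open>d + 1\<close> vertices; so the end is joined to all others. The path then
  closes up, and rotation brings every vertex to the end: a clique that is a component of
  \<open>S\<close>.\<close>

lemma closed_clique:
  assumes "finite S" "S \<noteq> {}" "1 \<le> d" and deg: "\<And>x. x \<in> S \<Longrightarrow> d \<le> card (nbrs S x)"
    and short: "\<And>xs. path xs \<Longrightarrow> set xs \<subseteq> S \<Longrightarrow> length xs \<noteq> d + 2"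
  obtains xs where "path xs" "set xs \<subseteq> S" "length xs = d + 1"
    "\<And>x. x \<in> set xs \<Longrightarrow> nbrs S x = set xs - {x}"
proof -
  obtain xs where xs: "path xs" "set xs \<subseteq> S" "xs \<noteq> []"
    and max: "\<And>ys. path ys \<Longrightarrow> set ys \<subseteq> S \<Longrightarrow> length ys \<le> length xs"
    using longest_path assms(1,2) by metis
  have bound: "length xs \<le> d + 1"
  proof (rule ccontr)
    assume "\<not> ?thesis"
    then have "length (take (d + 2) xs) = d + 2" by simp
    then show False
      using short[of "take (d + 2) xs"] xs by (meson order_trans path_take set_take_subset)
  qed
  \<comment> \<open>Every path on the vertices of \<open>xs\<close> is covered, so that rotations
    can be used below.\<close>
  have last: "length ys = d + 1 \<and> nbrs S (last ys) = set ys - {last ys}"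
    if ys: "path ys" "set ys = set xs" for ys
  proof -
    have len: "length ys = length xs"
      using ys xs(1) by (metis distinct_card path_def)
    have "ys \<noteq> []" using ys xs(3) by auto
    have sub: "nbrs S (last ys) \<subseteq> set ys - {last ys}"
      using ys xs max len \<open>ys \<noteq> []\<close> by (intro nbrs_last_longest_path) auto
    have "last ys \<in> set ys" using \<open>ys \<noteq> []\<close> by simp
    have c: "card (set ys - {last ys}) = length xs - 1"
      using ys(1) len \<open>last ys \<in> set ys\<close> by (simp add: path_def distinct_card)
    have "card (nbrs S (last ys)) \<le> length xs - 1"
      using card_mono[OF _ sub] c by simp
    moreover have "d \<le> card (nbrs S (last ys))"
      using deg \<open>last ys \<in> set ys\<close> ys(2) xs(2) by blast
    ultimately have "length xs = d + 1" "card (nbrs S (last ys)) = card (set ys - {last ys})"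
      using bound c assms(3) by linarith+
    then show ?thesis
      using card_subset_eq[OF _ sub] len by simp
  qed
  have len: "length xs = d + 1" and nb: "nbrs S (last xs) = set xs - {last xs}"
    using last[OF xs(1) refl] by blast+
  have "hd xs \<noteq> last xs"
    using xs(1,3) len assms(3) by (cases xs) (auto simp: path_def)
  then have "hd xs \<in> nbrs S (last xs)" using nb xs(3) by simp
  then have closing: "adj (last xs) (hd xs)" by (simp add: nbrs_def)
  have "nbrs S x = set xs - {x}" if "x \<in> set xs" for x
  proof -
    obtain i where i: "i < length xs" "x = xs ! i"
      using \<open>x \<in> set xs\<close> by (metis in_set_conv_nth)
    let ?ys = "rotate (Suc i) xs"
    have "last ?ys = x"
    proof -
      have "last ?ys = xs ! ((Suc i + (length xs - 1)) mod length xs)"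
        using xs(3) by (simp add: last_conv_nth nth_rotate del: rotate_Suc)
      also have "(Suc i + (length xs - 1)) mod length xs = i"
      proof -
        have "Suc i + (length xs - 1) = i + length xs" using i by simp
        then show ?thesis using i by simp
      qed
      finally show ?thesis using i by simp
    qed
    moreover have "path ?ys" "set ?ys = set xs"
      using path_rotate[OF xs(1) closing] by (simp_all only: set_rotate)
    ultimately show ?thesis
      using last by metis
  qed
  with that xs len show ?thesis by blast
qed

text \<open>Deleting \<open>v'\<close> from a critical subset lowers degrees by at most one. A path
  on \<open>l\<close> vertices in \<open>nbrs V v\<close> would close through \<open>v\<close>, so
  \<open>closed_clique\<close> with \<open>d = l - 2\<close> gives a clique whose vertices lack one
  neighbour, which can only be \<open>v'\<close>.\<close>

lemma has_cycle_if_nbrs_not_colourable: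
  assumes "finite V" "3 \<le> l" "v \<in> V" "v' \<in> V" "v \<noteq> v'" "X \<subseteq> nbrs V v" "v' \<notin> X"
    and "\<not> colourable (insert v' X) (l - 1)"
  shows "has_cycle V (l + 1)"
proof (rule ccontr)
  assume no: "\<not> has_cycle V (l + 1)"
  have XV: "X \<subseteq> V" using assms(6) by (auto simp: nbrs_def)
  then have finX: "finite (insert v' X)" using assms(1) finite_subset by auto
  obtain T where T: "T \<subseteq> insert v' X" "\<not> colourable T (l - 1)"
    and deg: "\<And>x. x \<in> T \<Longrightarrow> l - 1 \<le> card (nbrs T x)"
    using critical_subset finX assms(8) by metis
  have fin: "finite T" using T(1) finX finite_subset by blast
  define S where "S = T - {v'}"
  have "T \<noteq> {}" using T(2) by (auto simp: colourable_def proper_on_def)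
  have "S \<noteq> {}"
  proof
    assume "S = {}"
    then have "T = {v'}" using \<open>T \<noteq> {}\<close> by (auto simp: S_def)
    moreover have "nbrs {v'} v' = {}" by (auto simp: nbrs_def)
    ultimately show False using deg[of v'] assms(2) by simp
  qed
  have nT: "nbrs T x \<subseteq> insert v' (nbrs S x)" for x
    by (auto simp: S_def nbrs_def)
  have degS: "l - 2 \<le> card (nbrs S x)" if "x \<in> S" for x
  proof -
    have "card (nbrs T x) \<le> Suc (card (nbrs S x))"
      using card_mono[OF _ nT[of x]] fin card_insert_le_m1[of _ "nbrs S x" v']
      by (metis S_def card_insert_if finite_Diff finite_insert finite_nbrs le_SucI)
    then show ?thesis using deg[of x] that by (simp add: S_def)
  qed
  have SX: "S \<subseteq> X" using T(1) by (auto simp: S_def)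
  have short: "length xs \<noteq> l - 2 + 2" if "path xs" "set xs \<subseteq> S" for xs
  proof -
    have "set xs \<subseteq> nbrs V v" using that(2) SX assms(6) by blast
    then have "length xs \<noteq> l"
      using has_cycle_if_path_in_nbrs[OF assms(3) that(1), of l] assms(2) no by auto
    then show ?thesis using assms(2) by linarith
  qed
  have finS: "finite S" and l2: "1 \<le> l - 2"
    using fin assms(2) by (auto simp: S_def)
  obtain xs where xs: "path xs" "set xs \<subseteq> S" "length xs = l - 2 + 1"
    and nS: "\<And>x. x \<in> set xs \<Longrightarrow> nbrs S x = set xs - {x}"
    by (rule closed_clique[OF finS \<open>S \<noteq> {}\<close> l2 degS short]) (blast intro: that)+
  have adj': "adj x v'" if "x \<in> set xs" for x
  proof (rule ccontr)
    assume "\<not> adj x v'"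
    then have "nbrs T x = nbrs S x" by (auto simp: S_def nbrs_def)
    then have "card (nbrs T x) = l - 2"
      using nS[OF that] that xs by (simp add: path_def distinct_card)
    moreover have "x \<in> T" using that xs(2) by (auto simp: S_def)
    ultimately show False using deg[of x] assms(2) by simp
  qed
  obtain a ys where a: "xs = a # ys" "ys \<noteq> []"
    using xs(3) assms(2) by (cases xs; cases "tl xs") auto
  have "path ys" "a \<notin> set ys" using xs(1) a by (auto simp: path_Cons)
  have adjv: "adj v x" "x \<noteq> v'" if "x \<in> set xs" for x
    using that xs(2) SX assms(6) by (auto simp: nbrs_def S_def)
  have "hd ys \<in> set xs" "last ys \<in> set xs" using a by auto
  \<comment> \<open>The \<open>l - 1\<close> clique vertices are extended by \<open>v'\<close>,
    placed between \<open>a\<close> and the rest, and by \<open>v\<close>, which closes the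
    cycle.\<close>
  then have "path (v # a # v' # ys)"
  proof -
    have "v \<notin> set xs" "v' \<notin> set xs" using adjv adj_irrefl by blast+
    moreover have "adj v a" "adj a v'" "adj v' (hd ys)"
      using a adjv(1) adj' adj_sym[OF adj'[OF \<open>hd ys \<in> set xs\<close>]] by simp_all
    ultimately show ?thesis
      using \<open>path ys\<close> \<open>a \<notin> set ys\<close> a assms(5) by (auto simp: path_Cons)
  qed
  moreover have "adj (last (v # a # v' # ys)) (hd (v # a # v' # ys))"
    using a adjv[OF \<open>last ys \<in> set xs\<close>] by (simp add: adj_commute)
  moreover have "set (v # a # v' # ys) \<subseteq> V"
    using assms(3,4) XV SX xs(2) a by auto
  moreover have "length (v # a # v' # ys) = l + 1"
    using xs(3) a assms(2) by simp
  ultimately show False using no unfolding has_cycle_def by blast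
qed

text \<open>With \<open>l + t\<close> as the chromatic number, \<open>small\<close> expresses
  discrepancy at most \<open>t\<close>; the outcome is the complete graph on \<open>l\<close>
  vertices, which the theorem excludes.\<close>

lemma complete_if_small_discrepancy:
  fixes \<sigma> :: "'a \<Rightarrow> 'c"
  assumes fin: "finite V" "V \<noteq> {}" and "3 \<le> l" "3 * t \<le> 2 * l + 1"
    and no: "\<not> has_cycle V (l + 1)"
    and \<sigma>: "proper_on V \<sigma>"
    and chi: "\<not> colourable V (l + t - 1)"
    and small: "\<And>X k. X \<subseteq> V \<Longrightarrow> colourable X k \<Longrightarrow> card (\<sigma> ` X) \<le> k + t"
  shows "card V = l" "\<And>x y. x \<in> V \<Longrightarrow> y \<in> V \<Longrightarrow> x \<noteq> y \<Longrightarrow> adj x y"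
proof -
  have fin\<sigma>: "finite (\<sigma> ` V)" using fin by simp
  have "card (\<sigma> ` V) \<le> l + t"
  proof (rule ccontr)
    assume "\<not> ?thesis"
    then obtain C where C: "C \<subseteq> \<sigma> ` V" "card C = l + t + 1"
      using obtain_subset_with_card_n[of "l + t + 1" "\<sigma> ` V"] by auto
    then obtain T where T: "T \<subseteq> V" "C = \<sigma> ` T" "inj_on \<sigma> T"
      unfolding subset_image_inj by blast
    then have "card T = l + t + 1" using C by (simp add: card_image)
    moreover have "\<not> colourable T l" using small[OF T(1), of l] C T by auto
    moreover have "finite T" using T(1) fin finite_subset by blast
    ultimately have "has_cycle T (l + 1)"
      using assms(3,4) by (intro has_cycle_if_not_colourable) auto
    then show False using no has_cycle_mono T(1) by blast
  qed
  moreover have "\<not> card (\<sigma> ` V) \<le> l + t - 1"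
    using colourableI[OF \<sigma> fin\<sigma> order_refl] chi by blast
  ultimately have m: "card (\<sigma> ` V) = l + t" by simp
  have inj: "inj_on \<sigma> V"
  proof (rule ccontr)
    assume "\<not> inj_on \<sigma> V"
    then obtain x y where xy: "x \<in> V" "y \<in> V" "x \<noteq> y" "\<sigma> x = \<sigma> y"
      by (auto simp: inj_on_def)
    \<comment> \<open>If every vertex of the class missed some other colour, dissolving the class
      would save a colour, against \<open>chi\<close>.\<close>
    have "\<exists>v\<in>V. \<sigma> v = \<sigma> x \<and> \<sigma> ` V - {\<sigma> x} \<subseteq> \<sigma> ` nbrs V v"
    proof (rule ccontr)
      assume "\<not> ?thesis"
      then have "colourable V (card (\<sigma> ` V) - 1)"
        using xy(1) by (intro missed_colour_imp_colourable[OF fin(1) \<sigma>, of "\<sigma> x"]) blast+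
      with chi m show False by simp
    qed
    then obtain v where v: "v \<in> V" "\<sigma> v = \<sigma> x" "\<sigma> ` V - {\<sigma> x} \<subseteq> \<sigma> ` nbrs V v" by blast
    obtain v' where v': "v' \<in> V" "\<sigma> v' = \<sigma> v" "v' \<noteq> v"
      using xy v(2) by metis
    obtain X where X: "X \<subseteq> nbrs V v" "\<sigma> ` V - {\<sigma> x} = \<sigma> ` X"
      using v(3) unfolding subset_image_inj by blast
    have "\<sigma> ` insert v' X = \<sigma> ` V"
      using X(2) v v' xy(1) by auto
    moreover have "insert v' X \<subseteq> V" using X(1) v' by (auto simp: nbrs_def)
    \<comment> \<open>The set sees all \<open>l + t\<close> colours, one more than
      \<open>small\<close> would allow.\<close>
    ultimately have "\<not> colourable (insert v' X) (l - 1)"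
      using small[of "insert v' X" "l - 1"] m assms(3) by auto
    moreover have "v' \<notin> X" using X(2) v v' by auto
    ultimately show False
      using has_cycle_if_nbrs_not_colourable[OF fin(1) assms(3) v(1) v'(1)] v'(3) X(1) no by metis
  qed
  then have cV: "card V = l + t" using m by (simp add: card_image)
  show complete: "adj x y" if "x \<in> V" "y \<in> V" "x \<noteq> y" for x y
  proof (rule ccontr)
    assume "\<not> adj x y"
    \<comment> \<open>In the colouring by distinct vertices, non-adjacent \<open>x\<close> and
      \<open>y\<close> could share a colour, which saves one of \<open>l + t\<close>.\<close>
    then have "proper_on V (id(y := x))"
      by (auto simp: proper_on_def adj_commute)
    then have "colourable V (l + t - 1)"
      using fin that cV by (intro colourableI[of V "id(y := x)" "V - {y}"]) auto
    with chi show False by blast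
  qed
  show "card V = l"
  proof (rule ccontr)
    assume "card V \<noteq> l"
    then have "has_cycle V (l + 1)"
      using cV assms(3) fin complete by (intro has_cycle_if_clique) auto
    with no show False by blast
  qed
qed

end

section \<open>Induced subgraphs and discrepancies\<close>

sublocale graph \<subseteq> adjacency "dominates G"
proof
  show "x \<rightarrow>\<^bsub>G\<^esub> y \<Longrightarrow> y \<rightarrow>\<^bsub>G\<^esub> x" for x y
    by (rule graph_symmetric)
  show "\<not> x \<rightarrow>\<^bsub>G\<^esub> x" for x
    using adj_not_same by blast
qed

context graph begin

lemma proper_colouring_iff: "proper_colouring G \<sigma> \<longleftrightarrow> proper_on (verts G) \<sigma>"
  unfolding proper_colouring_def proper_on_def using adj_in_verts by blast

lemma chromatic_number_le_iff: "chromatic_number G \<le> k \<longleftrightarrow> colourable (verts G) k"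
proof -
  have *: "(\<exists>\<sigma> :: 'a \<Rightarrow> nat. proper_colouring G \<sigma> \<and> \<sigma> ` verts G \<subseteq> {..<k}) \<longleftrightarrow>
      colourable (verts G) k" for k
    by (auto simp: colourable_def proper_colouring_iff)
  have "colourable (verts G) (chromatic_number G)"
    unfolding chromatic_number_def * using colourable_card[OF finite_verts] by (rule LeastI)
  moreover have "colourable (verts G) k \<Longrightarrow> chromatic_number G \<le> k"
    unfolding chromatic_number_def * by (rule Least_le)
  ultimately show ?thesis
    using colourable_mono_bound by blast
qed

lemma chromatic_number_induce_le:
  assumes "X \<subseteq> verts G" "colourable X k"
  shows "chromatic_number (G \<restriction> X) \<le> k"
proof -
  obtain c :: "'a \<Rightarrow> nat" where "c ` X \<subseteq> {..<k}" "proper_on X c"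
    using assms(2) unfolding colourable_def by blast
  then have "proper_colouring (G \<restriction> X) c \<and> c ` verts (G \<restriction> X) \<subseteq> {..<k}"
    unfolding proper_colouring_def proper_on_def by (auto simp: arcs_ends_def arc_to_ends_def)
  then show ?thesis unfolding chromatic_number_def by (blast intro: Least_le)
qed

lemma colouring_discrepancy_ge:
  assumes "X \<subseteq> verts G" "X \<noteq> {}" "colourable X k"
  shows "int (card (\<sigma> ` X)) - int k \<le> colouring_discrepancy G \<sigma>"
proof -
  let ?A = "{int (card (\<sigma> ` verts H)) - int (chromatic_number H) | H.
            induced_subgraph H G \<and> verts H \<noteq> {}}"
  have "induced_subgraph (G \<restriction> X) G" using assms(1) by (rule induced_induce)
  then have "int (card (\<sigma> ` verts (G \<restriction> X))) - int (chromatic_number (G \<restriction> X)) \<in> ?A"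
    using assms(2) by force
  then have "int (card (\<sigma> ` X)) - int (chromatic_number (G \<restriction> X)) \<le> colouring_discrepancy G \<sigma>"
    unfolding colouring_discrepancy_def
    using colouring_discrepancy_set(1) assms(1,2) by (intro Max_ge) auto
  then show ?thesis using chromatic_number_induce_le[OF assms(1,3)] by linarith
qed

section \<open>From vertex lists to cycles of arcs\<close>

lemma awalk_of_path:
  assumes "path (u # xs)" "set (u # xs) \<subseteq> verts G"
  obtains p where "awalk u p (last (u # xs))" "awalk_verts u p = u # xs"
  using assms
proof (induction xs arbitrary: u thesis)
  case Nil
  then show ?case by (metis awalk_Nil_iff awalk_verts.simps(1) last.simps list.set_intros(1) subsetD)
next
  case (Cons x xs)
  then have "path (x # xs)" "u \<rightarrow>\<^bsub>G\<^esub> x" by (auto simp: path_Cons)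
  then obtain p where p: "awalk x p (last (x # xs))" "awalk_verts x p = x # xs"
    using Cons.IH Cons.prems(3) by (metis insert_subset list.simps(15))
  obtain e where e: "e \<in> arcs G" "tail G e = u" "head G e = x"
    using \<open>u \<rightarrow>\<^bsub>G\<^esub> x\<close> by (auto simp: arcs_ends_def arc_to_ends_def)
  have "awalk u (e # p) (last (u # x # xs))"
    using p e by (simp add: awalk_Cons_iff)
  moreover have "awalk_verts u (e # p) = u # x # xs" using p e by simp
  ultimately show ?case using Cons.prems(1) by blast
qed

lemma cycle_length_free_imp_no_cycle:
  assumes "cycle_length_free q G" "1 \<le> q"
  shows "\<not> has_cycle (verts G) q"
proof
  assume "has_cycle (verts G) q"
  then obtain xs where xs: "path xs" "set xs \<subseteq> verts G" "length xs = q"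
    "last xs \<rightarrow>\<^bsub>G\<^esub> hd xs"
    unfolding has_cycle_def by blast
  then obtain u ys where "xs = u # ys" using assms(2) by (cases xs) auto
  then obtain p where p: "awalk u p (last xs)" "awalk_verts u p = xs"
    using awalk_of_path xs by metis
  obtain e where e: "e \<in> arcs G" "tail G e = last xs" "head G e = u"
    using xs(4) \<open>xs = u # ys\<close> by (auto simp: arcs_ends_def arc_to_ends_def)
  then have "awalk (last xs) [e] u" using arc_implies_awalk[OF e(1)] by simp
  with p(1) have "awalk u (p @ [e]) u" by (rule awalk_appendI)
  moreover have "awalk_verts u (p @ [e]) = xs @ [u]"
    using p e \<open>xs = u # ys\<close> awalk_verts_append[OF \<open>awalk u (p @ [e]) u\<close>] by simp
  \<comment> \<open>Dropping the first entry of \<open>xs @ [u]\<close> leaves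
    \<open>ys @ [u]\<close>, a rearrangement of \<open>xs\<close> and hence distinct.\<close>
  ultimately have "cycle (p @ [e])"
    using xs(1) \<open>xs = u # ys\<close> unfolding cycle_def path_def by auto
  moreover have "length (p @ [e]) = q"
    using length_awalk_verts[of u p] p xs by simp
  ultimately show False using assms(1) unfolding cycle_length_free_def by blast
qed

end

theorem theorem1p11:
  fixes G :: "('a, 'b) pre_digraph" and l :: nat
  assumes "l \<ge> 3"
    and "graph G" and "verts G \<noteq> {}"
    and "cycle_length_free (l + 1) G"
    and "\<not> K\<^bsub>l\<^esub> G"
    and "real (chromatic_number G) < (5 * real l + 2) / 3"
  shows "chromatic_discrepancy G \<ge> int (chromatic_number G) - int l + 1"
proof -
  interpret graph G by fact
  let ?\<chi> = "chromatic_number G"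
  have "int ?\<chi> - int l + 1 \<le> colouring_discrepancy G \<sigma>" if "proper_colouring G \<sigma>" for \<sigma> :: "'a \<Rightarrow> nat"
  proof (rule ccontr)
    assume less: "\<not> ?thesis"
    obtain v where v: "v \<in> verts G" using assms(3) by blast
    \<comment> \<open>A single vertex gives discrepancy at least 0, so \<open>less\<close> forces
      \<open>l \<le> ?\<chi>\<close> and \<open>t\<close> can be a natural number.\<close>
    have "colourable {v} 1" using colourable_card[of "{v}"] by simp
    then have "l \<le> ?\<chi>"
      using colouring_discrepancy_ge[of "{v}" 1 \<sigma>] v less by simp
    then obtain t where t: "?\<chi> = l + t" using le_Suc_ex by blast
    have small: "card (\<sigma> ` X) \<le> k + t" if "X \<subseteq> verts G" "colourable X k" for X k
      using colouring_discrepancy_ge[OF that(1) _ that(2), of \<sigma>] less t by (cases "X = {}") auto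
    \<comment> \<open>The bound on the chromatic number reads
      \<open>3 * (l + t) < 5 * l + 2\<close>.\<close>
    have t_le: "3 * t \<le> 2 * l + 1" using assms(6) t by simp
    have chi: "\<not> colourable (verts G) (l + t - 1)"
    proof -
      have "\<not> ?\<chi> \<le> l + t - 1" using t assms(1) by linarith
      then show ?thesis unfolding chromatic_number_le_iff .
    qed
    have proper: "proper_on (verts G) \<sigma>" using that by (simp add: proper_colouring_iff)
    have no: "\<not> has_cycle (verts G) (l + 1)"
      using assms(4) by (intro cycle_length_free_imp_no_cycle) auto
    note complete = complete_if_small_discrepancy[OF finite_verts assms(3,1) t_le no proper chi small]
    have "arcs_ends G = {(u, v). (u, v) \<in> verts G \<times> verts G \<and> u \<noteq> v}"
    proof (intro set_eqI iffI)
      fix e assume "e \<in> arcs_ends G"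
      then show "e \<in> {(u, v). (u, v) \<in> verts G \<times> verts G \<and> u \<noteq> v}"
        using adj_in_verts adj_not_same by (cases e) blast
    qed (use complete(2) in blast)
    with complete(1) assms(2) have "K\<^bsub>l\<^esub> G"
      unfolding complete_digraph_def by blast
    with assms(5) show False by blast
  qed
  then show ?thesis
    unfolding chromatic_discrepancy_def
    using chromatic_discrepancy_set[OF assms(3)] by (subst Min_ge_iff) auto
qed

end
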